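(* Every tree of order $n$ has at least $n$ distinct nonisomorphic subtrees.
   Context: All trees are finite and nonempty, and the order of a tree is its number of vertices. A subtree of a tree is a nonempty connected subgraph (so a single vertex is a subtree, and the tree itself is a subtree). The number of distinct nonisomorphic subtrees of a tree is the number of isomorphism classes (as unrooted trees) of its subtrees. *)

theory Defs
  imports "Graph_Theory.Digraph_Isomorphism"
begin

text \<open>
  A finite simple undirected graph is a \<^locale>\<open>pair_graph\<close>: a finite symmetric loop-free digraph
  whose arcs are pairs of vertices, each undirected edge being a pair of opposite arcs.
  The library constant \<^const>\<open>tree\<close> is not usable here: it forbids directed cycles, and
  \<open>u, v, u\<close> is one whenever \<open>u\<close> and \<open>v\<close> are joined by an edge. In a \<^locale>\<open>pair_graph\<close> the
  cycles of length at least 3 are exactly the cycles of the undirected graph.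
  Note that \<^const>\<open>connected\<close> includes that there is at least one vertex.
\<close>

definition undirected_tree :: "'a pair_pre_digraph \<Rightarrow> bool" where
  "undirected_tree T \<longleftrightarrow> pair_graph T \<and> connected (with_proj T) \<and>
     \<not> (\<exists>p. pre_digraph.cycle (with_proj T) p \<and> 3 \<le> length p)"

text \<open>
  The condition \<^term>\<open>pair_graph H\<close> says that the arcs of \<open>H\<close> come from undirected edges.
\<close>

definition subtrees :: "'a pair_pre_digraph \<Rightarrow> 'a pair_pre_digraph set" where
  "subtrees T = {H. pair_graph H \<and> subgraph (with_proj H) (with_proj T) \<and> connected (with_proj H)}"

definition subtree_iso :: "'a pair_pre_digraph \<Rightarrow> 'a pair_pre_digraph rel" where
  "subtree_iso T = {(H, K). H \<in> subtrees T \<and> K \<in> subtrees T \<and>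
     digraph_iso (with_proj H) (with_proj K)}"

definition num_nonisomorphic_subtrees :: "'a pair_pre_digraph \<Rightarrow> nat" where
  "num_nonisomorphic_subtrees T = card (subtrees T // subtree_iso T)"

lemma digraph_iso_with_proj_iff:
  assumes "wf_digraph (with_proj H)"
  shows "digraph_iso (with_proj H) (with_proj K) \<longleftrightarrow>
    (\<exists>f. bij_betw f (pverts H) (pverts K) \<and> parcs K = (\<lambda>(u, v). (f u, f v)) ` parcs H)"
proof
  assume "digraph_iso (with_proj H) (with_proj K)"
  then obtain h where h: "pre_digraph.digraph_isomorphism (with_proj H) h"
    and K: "with_proj K = app_iso h (with_proj H)"
    unfolding digraph_iso_def by blast
  have ht: "iso_tail h = fst" "iso_head h = snd" and V: "pverts K = iso_verts h ` pverts H"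
    and A: "parcs K = iso_arcs h ` parcs H"
    using K by (auto simp: app_iso_def with_proj_def)
  have "iso_arcs h a = (\<lambda>(u, v). (iso_verts h u, iso_verts h v)) a" if "a \<in> parcs H" for a
    using h that ht unfolding pre_digraph.digraph_isomorphism_def
    by (auto simp: case_prod_unfold prod_eq_iff)
  then have "parcs K = (\<lambda>(u, v). (iso_verts h u, iso_verts h v)) ` parcs H"
    unfolding A by (intro image_cong) auto
  moreover have "bij_betw (iso_verts h) (pverts H) (pverts K)"
    using h V by (auto simp: pre_digraph.digraph_isomorphism_def bij_betw_def)
  ultimately show "\<exists>f. bij_betw f (pverts H) (pverts K) \<and> parcs K = (\<lambda>(u, v). (f u, f v)) ` parcs H"
    by blast
next
  assume "\<exists>f. bij_betw f (pverts H) (pverts K) \<and> parcs K = (\<lambda>(u, v). (f u, f v)) ` parcs H"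
  then obtain f where f: "bij_betw f (pverts H) (pverts K)"
    and A: "parcs K = (\<lambda>(u, v). (f u, f v)) ` parcs H" by blast
  let ?h = "\<lparr>iso_verts = f, iso_arcs = (\<lambda>(u, v). (f u, f v)), iso_head = snd, iso_tail = fst\<rparr>"
  have sub: "fst a \<in> pverts H \<and> snd a \<in> pverts H" if "a \<in> parcs H" for a
    using wf_digraph.tail_in_verts[OF assms, of a] wf_digraph.head_in_verts[OF assms, of a] that
    by simp
  have "inj_on (\<lambda>(u, v). (f u, f v)) (parcs H)"
    using f sub unfolding bij_betw_def inj_on_def by fastforce
  then have "pre_digraph.digraph_isomorphism (with_proj H) ?h"
    using f assms by (auto simp: pre_digraph.digraph_isomorphism_def bij_betw_def)
  moreover have "with_proj K = app_iso ?h (with_proj H)"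
    using f A by (simp add: app_iso_def with_proj_def bij_betw_def)
  ultimately show "digraph_iso (with_proj H) (with_proj K)"
    unfolding digraph_iso_def by blast
qed

lemma wf_digraph_subtree: "H \<in> subtrees T \<Longrightarrow> wf_digraph (with_proj H)"
  by (auto simp: subtrees_def subgraph_def)

lemma equiv_subtree_iso: "equiv (subtrees T) (subtree_iso T)"
proof (rule equivI)
  show "subtree_iso T \<subseteq> subtrees T \<times> subtrees T"
    by (auto simp: subtree_iso_def)
  show "refl_on (subtrees T) (subtree_iso T)"
  proof (rule refl_onI)
    fix H assume "H \<in> subtrees T"
    then show "(H, H) \<in> subtree_iso T"
      by (auto simp: subtree_iso_def digraph_iso_with_proj_iff wf_digraph_subtree
          intro!: exI[of _ "\<lambda>x. x"] bij_betw_imageI)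
  qed
  show "sym (subtree_iso T)"
  proof (rule symI)
    fix H K assume "(H, K) \<in> subtree_iso T"
    then have HK: "H \<in> subtrees T" "K \<in> subtrees T" "digraph_iso (with_proj H) (with_proj K)"
      by (auto simp: subtree_iso_def)
    have wf: "wf_digraph (with_proj H)" "wf_digraph (with_proj K)"
      using HK wf_digraph_subtree by blast+
    obtain f where f: "bij_betw f (pverts H) (pverts K)"
      and A: "parcs K = (\<lambda>(u, v). (f u, f v)) ` parcs H"
      using HK(3) digraph_iso_with_proj_iff[OF wf(1)] by blast
    have sub: "fst a \<in> pverts H \<and> snd a \<in> pverts H" if "a \<in> parcs H" for a
      using wf_digraph.tail_in_verts[OF wf(1), of a] wf_digraph.head_in_verts[OF wf(1), of a] that
      by simp
    define g where "g = the_inv_into (pverts H) f"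
    have gf: "g (f u) = u" if "u \<in> pverts H" for u
      using f that by (simp add: g_def bij_betw_def the_inv_into_f_f)
    have "(\<lambda>(u, v). (g u, g v)) ` parcs K = (\<lambda>a. a) ` parcs H"
      unfolding A image_image using sub gf by (intro image_cong) (auto simp: case_prod_unfold)
    moreover have "bij_betw g (pverts K) (pverts H)"
      unfolding g_def by (rule bij_betw_the_inv_into[OF f])
    ultimately have "digraph_iso (with_proj K) (with_proj H)"
      unfolding digraph_iso_with_proj_iff[OF wf(2)] by auto
    then show "(K, H) \<in> subtree_iso T"
      using HK by (simp add: subtree_iso_def)
  qed
  show "trans (subtree_iso T)"
  proof (rule transI)
    fix H K L assume "(H, K) \<in> subtree_iso T" "(K, L) \<in> subtree_iso T"
    then have HKL: "H \<in> subtrees T" "K \<in> subtrees T" "L \<in> subtrees T"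
      "digraph_iso (with_proj H) (with_proj K)" "digraph_iso (with_proj K) (with_proj L)"
      by (auto simp: subtree_iso_def)
    obtain f where f: "bij_betw f (pverts H) (pverts K)"
      "parcs K = (\<lambda>(u, v). (f u, f v)) ` parcs H"
      using HKL digraph_iso_with_proj_iff wf_digraph_subtree by metis
    obtain g where g: "bij_betw g (pverts K) (pverts L)"
      "parcs L = (\<lambda>(u, v). (g u, g v)) ` parcs K"
      using HKL digraph_iso_with_proj_iff wf_digraph_subtree by metis
    have "parcs L = (\<lambda>(u, v). ((g \<circ> f) u, (g \<circ> f) v)) ` parcs H"
      unfolding g(2) f(2) image_image by (simp add: case_prod_unfold)
    then have "digraph_iso (with_proj H) (with_proj L)"
      using bij_betw_trans[OF f(1) g(1)] digraph_iso_with_proj_iff wf_digraph_subtree[OF HKL(1)]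
      by blast
    then show "(H, L) \<in> subtree_iso T"
      using HKL by (simp add: subtree_iso_def)
  qed
qed

end

theory Submission
  imports Defs
begin

text \<open>
  Isomorphic subtrees have the same order, so it suffices to exhibit one subtree of \<open>T\<close> of each
  order \<open>1, \<dots>, n\<close>. These are found by growing: a single vertex is a subtree of order 1, and a
  subtree \<open>H\<close> that misses some vertex of \<open>T\<close> is joined by an edge of \<open>T\<close> to a vertex outside \<open>H\<close>,
  because \<open>T\<close> is connected; adding this edge and its outer end gives a subtree with one more vertex
  (\<open>exists_subtree_of_order\<close>). The isomorphism classes of the \<open>n\<close> subtrees are distinct, and there
  are only finitely many classes, so the number of classes is at least \<open>n\<close>.
\<close>

text \<open>
  \<^const>\<open>connected\<close> speaks of the symmetric closure of the arcs. In a \<^locale>\<open>pair_graph\<close> the arcs are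
  already symmetric, so plain reachability can be used instead.
\<close>

lemma connected_pair_graph_iff:
  assumes "pair_graph G"
  shows "connected (with_proj G) \<longleftrightarrow>
    pverts G \<noteq> {} \<and> (\<forall>u \<in> pverts G. \<forall>v \<in> pverts G. u \<rightarrow>\<^sup>*\<^bsub>with_proj G\<^esub> v)"
proof -
  interpret pair_graph G by fact
  have "(parcs G)\<^sup>s = parcs G"
    using arcs_symmetric by (auto simp: symcl_def)
  then show ?thesis
    by (simp add: connected_conv reachable_def)
qed

text \<open>
  A set of vertices that is closed under taking neighbours contains everything reachable from it.
\<close>

lemma exists_arc_leaving:
  assumes "pair_graph T" "connected (with_proj T)" "S \<subset> pverts T" "S \<noteq> {}"
  obtains u v where "u \<in> S" "v \<in> pverts T - S" "(u, v) \<in> parcs T"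
proof -
  from assms obtain a b where ab: "a \<in> S" "b \<in> pverts T" "b \<notin> S"
    by auto
  then have "a \<rightarrow>\<^sup>*\<^bsub>with_proj T\<^esub> b"
    using assms connected_pair_graph_iff[OF assms(1)] by blast
  then have "(a, b) \<in> rtrancl_on (pverts T) (parcs T)"
    by (simp add: reachable_def)
  then have "b \<in> S \<or> (\<exists>u \<in> S. \<exists>v \<in> pverts T - S. (u, v) \<in> parcs T)"
    by (induction rule: rtrancl_on_induct) (use ab in auto)
  then show thesis
    using ab that by blast
qed

lemma pair_graph_attach_leaf:
  assumes "pair_graph H" "u \<in> pverts H" "v \<notin> pverts H"
  shows "pair_graph \<lparr>pverts = insert v (pverts H), parcs = {(u, v), (v, u)} \<union> parcs H\<rparr>"
proof -
  interpret pair_graph H by fact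
  show ?thesis
    using assms(2,3) pair_finite_verts pair_finite_arcs
    by unfold_locales
      (auto simp: symmetric_def sym_def dest: in_arcsD1 in_arcsD2 no_loops' arcs_symmetric)
qed

lemma connected_attach_leaf:
  assumes "pair_graph H" "connected (with_proj H)" "u \<in> pverts H" "v \<notin> pverts H"
  shows "connected (with_proj
    \<lparr>pverts = insert v (pverts H), parcs = {(u, v), (v, u)} \<union> parcs H\<rparr>)"
    (is "connected (with_proj ?K)")
proof -
  have K: "pair_graph ?K"
    using assms by (intro pair_graph_attach_leaf)
  interpret K: pair_graph ?K by (rule K)
  have old: "x \<rightarrow>\<^sup>*\<^bsub>with_proj ?K\<^esub> y" if "x \<in> pverts H" "y \<in> pverts H" for x y
  proof -
    have "x \<rightarrow>\<^sup>*\<^bsub>with_proj H\<^esub> y"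
      using assms that connected_pair_graph_iff by blast
    then show ?thesis
      unfolding reachable_def by (rule rtrancl_on_mono[rotated 2]) auto
  qed
  have uv: "u \<rightarrow>\<^sup>*\<^bsub>with_proj ?K\<^esub> v" "v \<rightarrow>\<^sup>*\<^bsub>with_proj ?K\<^esub> u"
    using K.reachable_adjI by auto
  \<comment> \<open>Every vertex reaches \<open>u\<close> and is reached from it, so \<open>u\<close> serves as a hub.\<close>
  have hub: "x \<rightarrow>\<^sup>*\<^bsub>with_proj ?K\<^esub> u \<and> u \<rightarrow>\<^sup>*\<^bsub>with_proj ?K\<^esub> x" if "x \<in> pverts ?K" for x
    using that uv old assms(3) by auto
  have "pverts ?K \<noteq> {}"
    by simp
  then show ?thesis
    unfolding connected_pair_graph_iff[OF K] using hub K.reachable_trans by blast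
qed

lemma single_vertex_in_subtrees:
  assumes "pair_graph T" "r \<in> pverts T"
  shows "\<lparr>pverts = {r}, parcs = {}\<rparr> \<in> subtrees T" (is "?H \<in> _")
proof -
  interpret T: pair_graph T by fact
  have H: "pair_graph ?H"
    by unfold_locales (auto simp: symmetric_def sym_def)
  interpret H: pair_graph ?H by (rule H)
  have "subgraph (with_proj ?H) (with_proj T)"
    using assms T.wf_digraph_axioms H.wf_digraph_axioms by (auto simp: subgraph_def)
  then show ?thesis
    using H by (auto simp: subtrees_def connected_pair_graph_iff reachable_def)
qed

lemma attach_leaf_in_subtrees:
  assumes "pair_graph T" "H \<in> subtrees T"
    and "u \<in> pverts H" "v \<in> pverts T - pverts H" "(u, v) \<in> parcs T"
  shows "\<lparr>pverts = insert v (pverts H), parcs = {(u, v), (v, u)} \<union> parcs H\<rparr> \<in> subtrees T"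
    (is "?K \<in> _")
proof -
  interpret T: pair_graph T by fact
  have H: "pair_graph H" "subgraph (with_proj H) (with_proj T)" "connected (with_proj H)"
    using assms(2) by (auto simp: subtrees_def)
  have K: "pair_graph ?K" "connected (with_proj ?K)"
    using pair_graph_attach_leaf[OF H(1), of u v] connected_attach_leaf[OF H(1,3), of u v] assms
    by blast+
  interpret K: pair_graph ?K by (rule K(1))
  have "subgraph (with_proj ?K) (with_proj T)"
    using H(2) assms T.arcs_symmetric K.wf_digraph_axioms by (auto simp: subgraph_def)
  then show ?thesis
    using K by (simp add: subtrees_def)
qed

lemma exists_subtree_of_order:
  assumes "pair_graph T" "connected (with_proj T)"
    and "1 \<le> k" "k \<le> card (pverts T)"
  shows "\<exists>H \<in> subtrees T. card (pverts H) = k"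
  using assms(3,4)
proof (induction k rule: dec_induct)
  case base
  obtain r where "r \<in> pverts T"
    using assms connected_pair_graph_iff by blast
  then show ?case
    using single_vertex_in_subtrees[OF assms(1)] by force
next
  case (step k)
  then obtain H where H: "H \<in> subtrees T" "card (pverts H) = k"
    by auto
  then have fin: "finite (pverts H)"
    using \<open>1 \<le> k\<close> card.infinite by fastforce
  have "pverts H \<subset> pverts T" "pverts H \<noteq> {}"
    using H step by (auto simp: subtrees_def subgraph_def)
  with assms obtain u v where uv: "u \<in> pverts H" "v \<in> pverts T - pverts H" "(u, v) \<in> parcs T"
    using exists_arc_leaving by blast
  show ?case
    by (rule bexI[OF _ attach_leaf_in_subtrees[OF assms(1) H(1) uv]]) (use uv fin H in simp)
qed

lemma finite_subtrees:
  assumes "pair_graph T"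
  shows "finite (subtrees T)"
proof -
  interpret pair_graph T by fact
  let ?pair = "\<lambda>H :: 'a pair_pre_digraph. (pverts H, parcs H)"
  have "?pair ` subtrees T \<subseteq> Pow (pverts T) \<times> Pow (parcs T)"
    by (auto simp: subtrees_def subgraph_def)
  moreover have "inj_on ?pair (subtrees T)"
    by (auto intro!: inj_onI pair_pre_digraph.equality)
  ultimately show ?thesis
    using pair_finite_verts pair_finite_arcs by (meson finite_Pow_iff finite_SigmaI inj_on_finite)
qed

lemma subtree_iso_card_eq:
  assumes "(H, K) \<in> subtree_iso T"
  shows "card (pverts H) = card (pverts K)"
proof -
  have "H \<in> subtrees T" "digraph_iso (with_proj H) (with_proj K)"
    using assms by (auto simp: subtree_iso_def)
  then obtain f where "bij_betw f (pverts H) (pverts K)"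
    using digraph_iso_with_proj_iff wf_digraph_subtree by metis
  then show ?thesis
    by (rule bij_betw_same_card)
qed

theorem proposition1:
  fixes T :: "'a pair_pre_digraph" and n :: nat
  assumes "undirected_tree T" and "card (pverts T) = n"
  shows "num_nonisomorphic_subtrees T \<ge> n"
proof -
  have T: "pair_graph T" "connected (with_proj T)"
    using assms(1) by (auto simp: undirected_tree_def)
  have "\<forall>k \<in> {1..n}. \<exists>H \<in> subtrees T. card (pverts H) = k"
    using exists_subtree_of_order[OF T] assms(2) by auto
  then obtain H where H: "\<And>k. k \<in> {1..n} \<Longrightarrow> H k \<in> subtrees T \<and> card (pverts (H k)) = k"
    by metis
  let ?cls = "\<lambda>k. subtree_iso T `` {H k}"
  have "inj_on ?cls {1..n}"
  proof (rule inj_onI)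
    fix j k assume jk: "j \<in> {1..n}" "k \<in> {1..n}" "?cls j = ?cls k"
    then have "(H j, H k) \<in> subtree_iso T"
      using eq_equiv_class[OF _ equiv_subtree_iso] H by metis
    then show "j = k"
      using subtree_iso_card_eq H jk by metis
  qed
  moreover have "?cls ` {1..n} \<subseteq> subtrees T // subtree_iso T"
    using H by (auto intro: quotientI)
  moreover have "finite (subtrees T // subtree_iso T)"
    using finite_subtrees[OF T(1)] equiv_subtree_iso
    by (meson equiv_type finite_quotient)
  ultimately have "card {1..n} \<le> card (subtrees T // subtree_iso T)"
    by (rule card_inj_on_le)
  then show ?thesis
    by (simp add: num_nonisomorphic_subtrees_def)
qed

end
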